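(* Let $P$ be an Mtk on a countably generated measurable space $(\mathsf X,\mathcal B)$ such that $\tilde T(P)\ne\emptyset$, and let $\Pi$ denote its stationary distribution. Then \[ \rho^\dagger_{\mathrm{opt}}(P)\;\ge\;\inf_{C\in\mathcal B,\ \Pi(C)>1/2}(1-\varepsilon_C). \]
   Context: An Mtk (Markov transition kernel) is a Markov transition kernel $P:\mathsf X\times\mathcal B\to[0,1]$ on a countably generated measurable space $(\mathsf X,\mathcal B)$. Write $Pf(x)=\int_{\mathsf X}P(x,\mathrm dy)f(y)$, $P^m$ for the $m$-step kernel, and $\delta_xP^m=P^m(x,\cdot)$. Total variation distance: $d_{\mathrm{TV}}(\mu,\nu)=\sup_{A\in\mathcal B}[\mu(A)-\nu(A)]$. If $P$ has stationary probability measure $\Pi$, its convergence rate is \[ \rho_*(P)=\exp\Big[\sup_{x\in\mathsf X}\limsup_{m\to\infty}\frac{\log d_{\mathrm{TV}}(\delta_xP^m,\Pi)}{m}\Big]\in[0,1] \] (with $\log 0=-\infty$, $\exp(-\infty)=0$). Let $\tilde T_0=[0,1)\times[0,\infty)\times(0,1]\times[0,\infty)$. $P$ satisfies (B1)-(B3) with parameter $(\eta,L,\varepsilon,d)\in\tilde T_0$ if there are a measurable $V:\mathsf X\to[0,\infty)$ and a probability measure $\nu$ on $\mathcal B$ such that: (B1) $PV(x)\le\eta V(x)+L$ for all $x\in\mathsf X$; (B2) $d>0$ and $P(x,A)\ge\varepsilon\nu(A)$ for all $x\in C$, $A\in\mathcal B$, where $C=\{x\in\mathsf X:V(x)\le d\}$;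 (B3) $d>2L/(1-\eta)$. It is known that (B1)-(B3) imply that $P$ has a unique stationary distribution $\Pi$. Let $\tilde T(P)\subset\tilde T_0$ be the set of all parameters with which $P$ satisfies (B1)-(B3). Let $S_{\eta,L,\varepsilon,d}$ be the collection of all Mtks (on varying state spaces) satisfying (B1)-(B3) with parameter $(\eta,L,\varepsilon,d)$. (For set-theoretic reasons, the state spaces are taken from some fixed set of measurable spaces, which includes at least all finite sets of integers.) Define $\rho_{\mathrm{opt}}(\eta,L,\varepsilon,d)=\sup_{Q\in S_{\eta,L,\varepsilon,d}}\rho_*(Q)$ (equal to $0$ if $S_{\eta,L,\varepsilon,d}=\emptyset$), and \[ \rho^\dagger_{\mathrm{opt}}(P)=\inf_{(\eta,L,\varepsilon,d)\in\tilde T(P)}\rho_{\mathrm{opt}}(\eta,L,\varepsilon,d). \] For $C\in\mathcal B$, $\varepsilon_C$ is the supremum of all $\varepsilon\in(0,1]$ for which there is a probability measure $\nu$ on $\mathcal B$ with $P(x,A)\ge\varepsilon\nu(A)$ for all $x\in C$, $A\in\mathcal B$; $\varepsilon_C=0$ if no such $\varepsilon$ exists. *)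

theory Defs
  imports "HOL-Probability.Probability"
begin

definition countably_generated :: "'a measure \<Rightarrow> bool" where
  "countably_generated M \<longleftrightarrow>
     (\<exists>G. countable G \<and> G \<subseteq> Pow (space M) \<and> sets M = sigma_sets (space M) G)"

(* A measurable space is represented by a value of type 'a measure of which only space and sets
   are used. The values of a kernel P outside space M are irrelevant. *)
definition mtk :: "'a measure \<Rightarrow> ('a \<Rightarrow> 'a measure) \<Rightarrow> bool" where
  "mtk M P \<longleftrightarrow> countably_generated M \<and> P \<in> M \<rightarrow>\<^sub>M prob_algebra M"

primrec kernel_pow :: "'a measure \<Rightarrow> ('a \<Rightarrow> 'a measure) \<Rightarrow> nat \<Rightarrow> 'a \<Rightarrow> 'a measure" where
  "kernel_pow M P 0 x = return M x"
| "kernel_pow M P (Suc m) x = kernel_pow M P m x \<bind> P"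

definition tv_dist :: "'a measure \<Rightarrow> 'a measure \<Rightarrow> 'a measure \<Rightarrow> real" where
  "tv_dist M \<mu> \<nu> = (SUP A\<in>sets M. measure \<mu> A - measure \<nu> A)"

definition stationary :: "'a measure \<Rightarrow> ('a \<Rightarrow> 'a measure) \<Rightarrow> 'a measure \<Rightarrow> bool" where
  "stationary M P \<pi> \<longleftrightarrow> \<pi> \<in> space (prob_algebra M) \<and> \<pi> \<bind> P = \<pi>"

definition the_stationary :: "'a measure \<Rightarrow> ('a \<Rightarrow> 'a measure) \<Rightarrow> 'a measure" where
  "the_stationary M P = (THE \<pi>. stationary M P \<pi>)"

(* Logarithm on [0, \<infinity>) and exponential on [-\<infinity>, \<infinity>], with log 0 = -\<infinity> and exp (-\<infinity>) = 0
   (the library has ln 0 = 0). *)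
definition ext_ln :: "real \<Rightarrow> ereal" where
  "ext_ln t = (if t \<le> 0 then -\<infinity> else ereal (ln t))"

definition ext_exp :: "ereal \<Rightarrow> ennreal" where
  "ext_exp t = (if t = -\<infinity> then 0 else if t = \<infinity> then \<infinity> else ennreal (exp (real_of_ereal t)))"

(* Meaningful when the stationary distribution exists and is unique. *)
definition rho_star :: "'a measure \<Rightarrow> ('a \<Rightarrow> 'a measure) \<Rightarrow> ennreal" where
  "rho_star M P = ext_exp (SUP x\<in>space M.
     limsup (\<lambda>m. ext_ln (tv_dist M (kernel_pow M P m x) (the_stationary M P)) / ereal (real m)))"

definition minorizes ::
    "'a measure \<Rightarrow> ('a \<Rightarrow> 'a measure) \<Rightarrow> 'a set \<Rightarrow> real \<Rightarrow> 'a measure \<Rightarrow> bool" where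
  "minorizes M P C \<epsilon> \<nu> \<longleftrightarrow>
     (\<forall>x\<in>C. \<forall>A\<in>sets M. measure (P x) A \<ge> \<epsilon> * measure \<nu> A)"

type_synonym param = "real \<times> real \<times> real \<times> real"

definition T0 :: "param set" where
  "T0 = {0..<1} \<times> {0..} \<times> {0<..1} \<times> {0..}"

fun drift_minorization :: "'a measure \<Rightarrow> ('a \<Rightarrow> 'a measure) \<Rightarrow> param \<Rightarrow> bool" where
  "drift_minorization M P (\<eta>, L, \<epsilon>, d) \<longleftrightarrow>
     (\<exists>V \<nu>. V \<in> borel_measurable M \<and> (\<forall>x\<in>space M. 0 \<le> V x) \<and> \<nu> \<in> space (prob_algebra M) \<and>
        (\<forall>x\<in>space M. (\<integral>\<^sup>+ y. ennreal (V y) \<partial>P x) \<le> ennreal (\<eta> * V x + L)) \<and>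
        d > 0 \<and> minorizes M P {x \<in> space M. V x \<le> d} \<epsilon> \<nu> \<and>
        d > 2 * L / (1 - \<eta>))"

definition T_params :: "'a measure \<Rightarrow> ('a \<Rightarrow> 'a measure) \<Rightarrow> param set" where
  "T_params M P = {\<theta> \<in> T0. drift_minorization M P \<theta>}"

(* A set of measurable spaces containing every nonempty finite set of integers (with its discrete
   sigma-algebra); \<iota> makes the integers available in the type carrying the state spaces. *)
definition state_space_family :: "'u measure set \<Rightarrow> bool" where
  "state_space_family \<U> \<longleftrightarrow>
     (\<exists>\<iota> :: int \<Rightarrow> 'u. inj \<iota> \<and>
        (\<forall>F. finite F \<and> F \<noteq> {} \<longrightarrow> (\<exists>N\<in>\<U>. sets N = sets (count_space (\<iota> ` F)))))"

definition S_class :: "'u measure set \<Rightarrow> param \<Rightarrow> ('u measure \<times> ('u \<Rightarrow> 'u measure)) set" where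
  "S_class \<U> \<theta> = {(N, Q). N \<in> \<U> \<and> mtk N Q \<and> drift_minorization N Q \<theta>}"

(* In ennreal the supremum over the empty set is 0. *)
definition rho_opt :: "'u measure set \<Rightarrow> param \<Rightarrow> ennreal" where
  "rho_opt \<U> \<theta> = (SUP (N, Q)\<in>S_class \<U> \<theta>. rho_star N Q)"

definition rho_opt_dagger :: "'u measure set \<Rightarrow> 'a measure \<Rightarrow> ('a \<Rightarrow> 'a measure) \<Rightarrow> ennreal" where
  "rho_opt_dagger \<U> M P = (INF \<theta>\<in>T_params M P. rho_opt \<U> \<theta>)"

definition eps_set :: "'a measure \<Rightarrow> ('a \<Rightarrow> 'a measure) \<Rightarrow> 'a set \<Rightarrow> real set" where
  "eps_set M P C = {\<epsilon> \<in> {0<..1}. \<exists>\<nu>\<in>space (prob_algebra M). minorizes M P C \<epsilon> \<nu>}"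

definition eps_C :: "'a measure \<Rightarrow> ('a \<Rightarrow> 'a measure) \<Rightarrow> 'a set \<Rightarrow> real" where
  "eps_C M P C = (if eps_set M P C = {} then 0 else Sup (eps_set M P C))"

end

theory Submission
  imports Defs
begin

text \<open>
  Fix a parameter \<open>(\<eta>, L, \<epsilon>, d)\<close> with which \<open>P\<close> satisfies the drift and minorization
  conditions, with drift function \<open>V\<close> and small set \<open>C = {V \<le> d}\<close>. The claim follows by
  bounding \<open>1 - \<epsilon>\<close> from both sides.

  From below: integrating the drift inequality against the stationary distribution \<open>\<pi>\<close> gives
  \<open>\<pi>(V) \<le> L / (1 - \<eta>)\<close>, and since \<open>d > 2 L / (1 - \<eta>)\<close>, Markov's inequality gives
  \<open>\<pi>(C) > 1/2\<close> (\<open>stationary_sublevel_gt_half\<close>). So \<open>C\<close> takes part in the infimum, and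
  \<open>\<epsilon> \<le> \<epsilon>\<^sub>C\<close>; the infimum is at most \<open>1 - \<epsilon>\<close>. As \<open>V\<close> is not known to be integrable, the
  integration has to be done on truncations of \<open>V\<close> (\<open>stationary_drift_integral_le\<close>).

  From above: the worst-case rate for the parameter is at least \<open>1 - \<epsilon>\<close> (\<open>rho_opt_ge\<close>). The
  drift condition allows \<open>V = 0\<close>, in which case only the minorization is a constraint, and it
  is then imposed on the whole space. A chain on two points \<open>z\<close>, \<open>x\<close> that jumps to \<open>z\<close> with
  probability \<open>\<epsilon>\<close> and otherwise stays where it is satisfies it. Its stationary distribution is
  the point mass at \<open>z\<close>, while \<open>Q\<^sup>m(x, {x}) = (1 - \<epsilon>)\<^sup>m\<close>, so it converges no faster than at
  the rate \<open>1 - \<epsilon>\<close>.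
\<close>

section \<open>Slow convergence from an atom that the stationary distribution does not charge\<close>

lemma mtk_measurable_subprob: "mtk N Q \<Longrightarrow> Q \<in> N \<rightarrow>\<^sub>M subprob_algebra N"
  unfolding mtk_def by (simp add: measurable_prob_algebraD)

lemma emeasure_bind_mtk:
  assumes "mtk N Q" "\<mu> \<in> space (prob_algebra N)" "A \<in> sets N"
  shows "emeasure (\<mu> \<bind> Q) A = (\<integral>\<^sup>+ y. emeasure (Q y) A \<partial>\<mu>)"
  using emeasure_bind_prob_algebra[OF assms(2) _ assms(3)] assms(1) by (simp add: mtk_def)

lemma kernel_pow_in_prob_algebra:
  assumes "mtk N Q" "x \<in> space N"
  shows "kernel_pow N Q m x \<in> space (prob_algebra N)"
proof (induction m)
  case 0
  show ?case
    using assms(2) by (simp add: space_prob_algebra prob_space_return)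
next
  case (Suc m)
  have Q: "Q \<in> N \<rightarrow>\<^sub>M prob_algebra N"
    using assms(1) by (simp add: mtk_def)
  have "(\<lambda>_::unit. kernel_pow N Q m x \<bind> Q) \<in> count_space UNIV \<rightarrow>\<^sub>M prob_algebra N"
    by (rule measurable_bind_prob_space[OF _ Q]) (use Suc in simp)
  then show ?case
    by (auto dest!: measurable_space[where x = "()"])
qed

lemma bind_atom_ge:
  assumes Q: "mtk N Q" and \<mu>: "\<mu> \<in> space (prob_algebra N)" and x: "{x} \<in> sets N"
  shows "emeasure (\<mu> \<bind> Q) {x} \<ge> emeasure (Q x) {x} * emeasure \<mu> {x}"
proof -
  have sets: "sets \<mu> = sets N"
    using \<mu> by (simp add: space_prob_algebra)
  have "emeasure (Q x) {x} * emeasure \<mu> {x} = (\<integral>\<^sup>+ y. emeasure (Q x) {x} * indicator {x} y \<partial>\<mu>)"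
    using x sets by (simp add: nn_integral_cmult_indicator)
  also have "\<dots> \<le> (\<integral>\<^sup>+ y. emeasure (Q y) {x} \<partial>\<mu>)"
    by (intro nn_integral_mono) (auto simp: indicator_def)
  also have "\<dots> = emeasure (\<mu> \<bind> Q) {x}"
    using emeasure_bind_mtk[OF Q \<mu> x] by simp
  finally show ?thesis .
qed

lemma kernel_pow_atom_ge:
  assumes Q: "mtk N Q" and x: "x \<in> space N" "{x} \<in> sets N"
  shows "emeasure (kernel_pow N Q m x) {x} \<ge> emeasure (Q x) {x} ^ m"
proof (induction m)
  case 0
  show ?case using x by simp
next
  case (Suc m)
  have "emeasure (Q x) {x} ^ Suc m \<le> emeasure (Q x) {x} * emeasure (kernel_pow N Q m x) {x}"
    using Suc by (simp add: mult_left_mono)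
  also have "\<dots> \<le> emeasure (kernel_pow N Q (Suc m) x) {x}"
    using bind_atom_ge[OF Q kernel_pow_in_prob_algebra[OF Q x(1), of m] x(2)] by simp
  finally show ?case .
qed

lemma tv_dist_ge:
  assumes \<mu>: "\<mu> \<in> space (prob_algebra N)" and A: "A \<in> sets N"
  shows "tv_dist N \<mu> \<pi> \<ge> measure \<mu> A - measure \<pi> A"
  unfolding tv_dist_def
proof (rule cSUP_upper[OF A])
  have "prob_space \<mu>"
    using \<mu> by (simp add: space_prob_algebra)
  then have "measure \<mu> B - measure \<pi> B \<le> 1" for B
    using prob_space.prob_le_1[of \<mu> B] measure_nonneg[of \<pi> B] by linarith
  then show "bdd_above ((\<lambda>B. measure \<mu> B - measure \<pi> B) ` sets N)"
    by (intro bdd_aboveI[of _ 1]) auto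
qed

lemma ext_exp_mono: "s \<le> t \<Longrightarrow> ext_exp s \<le> ext_exp t"
  unfolding ext_exp_def by (cases s; cases t) (auto intro: ennreal_leI)

lemma ext_ln_mono: "s \<le> t \<Longrightarrow> ext_ln s \<le> ext_ln t"
  unfolding ext_ln_def by auto

text \<open>
  A chain started at \<open>x\<close> that stays at \<open>x\<close> with probability at least \<open>r\<close> in each step still
  has mass at least \<open>r\<^sup>m\<close> there after \<open>m\<close> steps. If the stationary distribution puts no mass
  on \<open>x\<close>, the event \<open>{x}\<close> alone keeps the total variation distance above \<open>r\<^sup>m\<close>.
\<close>

lemma rho_star_ge_of_atom:
  assumes Q: "mtk N Q" and x: "x \<in> space N" "{x} \<in> sets N"
    and null: "measure (the_stationary N Q) {x} = 0"
    and r: "0 < r" "ennreal r \<le> emeasure (Q x) {x}"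
  shows "ennreal r \<le> rho_star N Q"
proof -
  let ?tv = "\<lambda>m. tv_dist N (kernel_pow N Q m x) (the_stationary N Q)"
  have tv: "r ^ m \<le> ?tv m" for m
  proof -
    have K: "kernel_pow N Q m x \<in> space (prob_algebra N)"
      by (rule kernel_pow_in_prob_algebra[OF Q x(1)])
    then interpret prob_space "kernel_pow N Q m x"
      by (simp add: space_prob_algebra)
    have "ennreal (r ^ m) = ennreal r ^ m"
      using r(1) by (simp add: ennreal_power)
    also have "\<dots> \<le> emeasure (Q x) {x} ^ m"
      by (intro power_mono r(2)) auto
    also have "\<dots> \<le> ennreal (measure (kernel_pow N Q m x) {x})"
      using kernel_pow_atom_ge[OF Q x, of m] by (simp add: emeasure_eq_measure)
    finally have "r ^ m \<le> measure (kernel_pow N Q m x) {x}"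
      by simp
    also have "\<dots> \<le> ?tv m"
      using tv_dist_ge[OF K x(2), of "the_stationary N Q"] null by simp
    finally show ?thesis .
  qed
  (* For m = 0 the quotient is a division by zero; the limit superior ignores that term. *)
  have "ereal (ln r) \<le> ext_ln (?tv m) / ereal (real m)" if "m > 0" for m
  proof -
    have "ereal (ln r) = ext_ln (r ^ m) / ereal (real m)"
      using r(1) that by (simp add: ext_ln_def ln_realpow not_le)
    also have "\<dots> \<le> ext_ln (?tv m) / ereal (real m)"
      using that by (intro ereal_divide_right_mono ext_ln_mono tv) auto
    finally show ?thesis .
  qed
  then have "ereal (ln r) \<le> limsup (\<lambda>m. ext_ln (?tv m) / ereal (real m))"
    by (intro le_Limsup) (auto intro: eventually_mono[OF eventually_gt_at_top[of 0]])
  then have le: "ereal (ln r) \<le> (SUP x\<in>space N.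
      limsup (\<lambda>m. ext_ln (tv_dist N (kernel_pow N Q m x) (the_stationary N Q)) / ereal (real m)))"
    by (rule SUP_upper2[OF x(1)])
  have "ennreal r = ext_exp (ereal (ln r))"
    using r(1) by (simp add: ext_exp_def)
  also have "\<dots> \<le> rho_star N Q"
    unfolding rho_star_def by (rule ext_exp_mono[OF le])
  finally show ?thesis .
qed

section \<open>The two-point reset chain\<close>

text \<open>
  This is the mixture \<open>\<epsilon> \<delta>\<^sub>z + (1 - \<epsilon>) \<delta>\<^sub>x\<close>, written as the law of a coin-controlled choice
  because a distribution of that form is a probability measure on \<open>N\<close> by construction.
\<close>

definition reset_kernel :: "'a measure \<Rightarrow> real \<Rightarrow> 'a \<Rightarrow> 'a \<Rightarrow> 'a measure" where
  "reset_kernel N \<epsilon> z x = distr (measure_pmf (bernoulli_pmf \<epsilon>)) N (\<lambda>b. if b then z else x)"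

lemma emeasure_reset_kernel:
  assumes "z \<in> space N" "x \<in> space N" "A \<in> sets N" "0 \<le> \<epsilon>" "\<epsilon> \<le> 1"
  shows "emeasure (reset_kernel N \<epsilon> z x) A
    = ennreal (\<epsilon> * indicator A z + (1 - \<epsilon>) * indicator A x)"
proof -
  have m: "(\<lambda>b. if b then z else x) \<in> measure_pmf (bernoulli_pmf \<epsilon>) \<rightarrow>\<^sub>M N"
    using assms(1,2) by auto
  have "emeasure (reset_kernel N \<epsilon> z x) A
      = (\<integral>\<^sup>+ b. indicator A (if b then z else x) \<partial>measure_pmf (bernoulli_pmf \<epsilon>))"
    unfolding reset_kernel_def
    using nn_integral_distr[OF m, of "indicator A"] assms(3) by simp
  also have "\<dots> = ennreal (\<epsilon> * indicator A z + (1 - \<epsilon>) * indicator A x)"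
    using assms(4,5) by (auto simp: indicator_def simp flip: ennreal_plus)
  finally show ?thesis .
qed

lemma reset_kernel_in_prob_algebra:
  assumes "z \<in> space N" "x \<in> space N"
  shows "reset_kernel N \<epsilon> z x \<in> space (prob_algebra N)"
  unfolding reset_kernel_def space_prob_algebra
  using assms by (auto intro!: prob_space.prob_space_distr measure_pmf.prob_space_axioms)

text \<open>
  In each step the mass on \<open>x\<close> is multiplied by \<open>1 - \<epsilon> < 1\<close>, so that an invariant
  distribution has none there.
\<close>

lemma the_stationary_reset_kernel:
  assumes sets: "sets N = Pow {z, x}" and "z \<noteq> x" and \<epsilon>: "0 < \<epsilon>" "\<epsilon> \<le> 1"
    and mtk: "mtk N (reset_kernel N \<epsilon> z)"
  shows "the_stationary N (reset_kernel N \<epsilon> z) = return N z"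
  unfolding the_stationary_def
proof (rule the_equality)
  have sp: "space N = {z, x}"
    using sets_eq_imp_space_eq[of N "count_space {z, x}"] sets by simp
  have "reset_kernel N \<epsilon> z z = return N z"
  proof (rule measure_eqI)
    fix A assume "A \<in> sets (reset_kernel N \<epsilon> z z)"
    then have "A \<in> sets N" by (simp add: reset_kernel_def)
    then show "emeasure (reset_kernel N \<epsilon> z z) A = emeasure (return N z) A"
      using emeasure_reset_kernel[of z N z A \<epsilon>] sp \<epsilon>
      by (simp add: indicator_def flip: ennreal_plus)
  qed (simp add: reset_kernel_def)
  then show "stationary N (reset_kernel N \<epsilon> z) (return N z)"
    using bind_return[OF mtk_measurable_subprob[OF mtk], of z] sp
    by (simp add: stationary_def space_prob_algebra prob_space_return)
  fix \<mu> assume \<mu>: "stationary N (reset_kernel N \<epsilon> z) \<mu>"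
  then have \<mu>_prob: "\<mu> \<in> space (prob_algebra N)" and inv: "\<mu> \<bind> reset_kernel N \<epsilon> z = \<mu>"
    by (auto simp: stationary_def)
  then have s\<mu>: "sets \<mu> = sets N" and "prob_space \<mu>"
    by (auto simp: space_prob_algebra)
  then interpret prob_space \<mu> by simp
  have sp\<mu>: "space \<mu> = {z, x}"
    using sets_eq_imp_space_eq[OF s\<mu>] sp by simp
  have "emeasure \<mu> {x} = (\<integral>\<^sup>+ y. emeasure (reset_kernel N \<epsilon> z y) {x} \<partial>\<mu>)"
    using emeasure_bind_mtk[OF mtk \<mu>_prob, of "{x}"] inv sets by simp
  also have "\<dots> = (\<integral>\<^sup>+ y. ennreal (1 - \<epsilon>) * indicator {x} y \<partial>\<mu>)"
    using sp sp\<mu> sets \<epsilon> \<open>z \<noteq> x\<close>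
    by (intro nn_integral_cong) (auto simp: emeasure_reset_kernel indicator_def)
  also have "\<dots> = ennreal (1 - \<epsilon>) * emeasure \<mu> {x}"
    using s\<mu> sets by (simp add: nn_integral_cmult_indicator)
  finally have "measure \<mu> {x} = (1 - \<epsilon>) * measure \<mu> {x}"
    using \<epsilon> by (simp add: emeasure_eq_measure flip: ennreal_mult)
  then have x0: "measure \<mu> {x} = 0"
    using \<epsilon> by (simp add: algebra_simps)
  then have z1: "AE y in \<mu>. y = z"
    using sp\<mu> s\<mu> sets by (intro AE_I[of _ _ "{x}"]) (auto simp: emeasure_eq_measure)
  show "\<mu> = return N z"
  proof (rule measure_eqI)
    fix A assume A: "A \<in> sets \<mu>"
    have "emeasure \<mu> A = (\<integral>\<^sup>+ y. indicator A y \<partial>\<mu>)"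
      using A by simp
    also have "\<dots> = (\<integral>\<^sup>+ y. indicator A z \<partial>\<mu>)"
      using z1 by (intro nn_integral_cong_AE) auto
    also have "\<dots> = emeasure (return N z) A"
      using A s\<mu> by (simp add: emeasure_space_1)
    finally show "emeasure \<mu> A = emeasure (return N z) A" .
  qed (simp add: s\<mu>)
qed

text \<open>
  The witness is the reset chain on a two-point space with the drift function \<open>V = 0\<close>, for
  which the drift condition reads \<open>0 \<le> L\<close> and every point lies in the small set.
\<close>

lemma rho_opt_ge:
  assumes U: "state_space_family \<U>"
    and \<epsilon>: "0 < \<epsilon>" "\<epsilon> < 1" and "0 \<le> L" "0 < d" "d > 2 * L / (1 - \<eta>)"
  shows "ennreal (1 - \<epsilon>) \<le> rho_opt \<U> (\<eta>, L, \<epsilon>, d)"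
proof -
  obtain \<iota> :: "int \<Rightarrow> 'a" where \<iota>: "inj \<iota>"
    and ex: "\<And>F. finite F \<and> F \<noteq> {} \<longrightarrow> (\<exists>N\<in>\<U>. sets N = sets (count_space (\<iota> ` F)))"
    using U unfolding state_space_family_def by blast
  define z x where "z = \<iota> 0" and "x = \<iota> 1"
  have "z \<noteq> x"
    using \<iota> by (simp add: z_def x_def inj_eq)
  obtain N where N: "N \<in> \<U>" "sets N = sets (count_space {z, x})"
    using ex[of "{0, 1}"] by (auto simp: z_def x_def)
  then have sets: "sets N = Pow {z, x}" and sp: "space N = {z, x}"
    using sets_eq_imp_space_eq[OF N(2)] by simp_all
  let ?Q = "reset_kernel N \<epsilon> z"
  have "countably_generated N"
    unfolding countably_generated_def
    using sets sp by (intro exI[of _ "Pow {z, x}"])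
      (simp add: countable_finite sigma_algebra.sigma_sets_eq[OF sigma_algebra_Pow])
  moreover have "?Q \<in> N \<rightarrow>\<^sub>M prob_algebra N"
    using reset_kernel_in_prob_algebra[of z N] sp
    by (subst measurable_cong_sets[OF N(2) refl]) (auto simp: Pi_iff)
  ultimately have mtk: "mtk N ?Q"
    by (simp add: mtk_def)
  have "drift_minorization N ?Q (\<eta>, L, \<epsilon>, d)"
    unfolding drift_minorization.simps
  proof (intro exI conjI)
    show "return N z \<in> space (prob_algebra N)"
      using sp by (simp add: space_prob_algebra prob_space_return)
    show "minorizes N ?Q {y \<in> space N. (\<lambda>_. 0) y \<le> d} \<epsilon> (return N z)"
      unfolding minorizes_def
    proof (intro ballI)
      fix y A assume "y \<in> {y \<in> space N. (\<lambda>_. 0::real) y \<le> d}" and A: "A \<in> sets N"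
      then show "\<epsilon> * measure (return N z) A \<le> measure (?Q y) A"
        using emeasure_reset_kernel[of z N y A \<epsilon>] sp \<epsilon>
        by (auto simp: measure_def indicator_def simp flip: ennreal_plus)
    qed
  qed (use assms in auto)
  then have mem: "(N, ?Q) \<in> S_class \<U> (\<eta>, L, \<epsilon>, d)"
    using N(1) mtk by (simp add: S_class_def)
  have "ennreal (1 - \<epsilon>) \<le> rho_star N ?Q"
  proof (rule rho_star_ge_of_atom[OF mtk])
    show "measure (the_stationary N ?Q) {x} = 0"
      using the_stationary_reset_kernel[OF sets \<open>z \<noteq> x\<close> \<epsilon>(1) less_imp_le[OF \<epsilon>(2)] mtk] sets \<open>z \<noteq> x\<close>
      by (simp add: measure_return)
    show "ennreal (1 - \<epsilon>) \<le> emeasure (?Q x) {x}"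
      using emeasure_reset_kernel[of z N x "{x}" \<epsilon>] sp sets \<epsilon> \<open>z \<noteq> x\<close> by simp
  qed (use sp sets \<epsilon> in auto)
  also have "\<dots> \<le> rho_opt \<U> (\<eta>, L, \<epsilon>, d)"
    unfolding rho_opt_def using SUP_upper[OF mem, of "\<lambda>(N, Q). rho_star N Q"] by simp
  finally show ?thesis .
qed

section \<open>Stationary mass of sublevel sets of a drift function\<close>

text \<open>
  If \<open>\<pi>(V)\<close> were known to be finite, one would integrate \<open>P V \<le> \<eta> V + L\<close> and cancel. In
  general, invariance is applied to the truncations \<open>min V n\<close>: they satisfy
  \<open>P (min V n) \<le> min (\<eta> V + L) n\<close>, so the bounded function
  \<open>min V n - min (\<eta> V + L) n\<close> has nonpositive \<open>\<pi>\<close>-integral. It is bounded below by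
  \<open>- L\<close> uniformly in \<open>n\<close> and tends to \<open>(1 - \<eta>) V - L\<close>, so Fatou's lemma applies after
  adding \<open>L\<close>.
\<close>

lemma stationary_drift_integral_le:
  assumes P: "mtk M P" and \<pi>: "stationary M P \<pi>"
    and V[measurable]: "V \<in> borel_measurable M" and V_nonneg: "\<And>x. x \<in> space M \<Longrightarrow> 0 \<le> V x"
    and \<eta>: "0 \<le> \<eta>" "\<eta> < 1" and L: "0 \<le> L"
    and drift: "\<And>x. x \<in> space M \<Longrightarrow> (\<integral>\<^sup>+ y. ennreal (V y) \<partial>P x) \<le> ennreal (\<eta> * V x + L)"
  shows "(\<integral>\<^sup>+ x. ennreal ((1 - \<eta>) * V x) \<partial>\<pi>) \<le> ennreal L"
proof -
  have sets[measurable_cong]: "sets \<pi> = sets M" and "prob_space \<pi>" and inv: "\<pi> \<bind> P = \<pi>"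
    using \<pi> by (auto simp: stationary_def space_prob_algebra)
  then interpret prob_space \<pi> by simp
  have space: "space \<pi> = space M"
    by (rule sets_eq_imp_space_eq[OF sets])
  have P_prob: "prob_space (P x)" and P_sets: "sets (P x) = sets M" if "x \<in> space M" for x
    using measurable_space[of P M "prob_algebra M" x] P that by (auto simp: mtk_def space_prob_algebra)
  let ?h = "\<lambda>n x. min (V x) (real n) + L - min (\<eta> * V x + L) (real n)"
  have h_nonneg: "0 \<le> ?h n x" if "x \<in> space M" for n x
  proof -
    have "\<eta> * V x \<le> 1 * V x"
      using V_nonneg[OF that] \<eta> by (intro mult_right_mono) auto
    then show ?thesis using L by (auto simp: min_def)
  qed
  (* The inequality is proved in additive form, with the finite integral ?b on both sides, since
     subtraction of extended nonnegative reals truncates. *)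
  have h_int: "(\<integral>\<^sup>+ x. ennreal (?h n x) \<partial>\<pi>) \<le> ennreal L" for n
  proof -
    let ?b = "\<integral>\<^sup>+ x. ennreal (min (\<eta> * V x + L) (real n)) \<partial>\<pi>"
    have "?b \<le> (\<integral>\<^sup>+ x. ennreal (real n) \<partial>\<pi>)"
      by (intro nn_integral_mono ennreal_leI) auto
    then have fin: "?b \<noteq> \<infinity>"
      by (auto simp: emeasure_space_1 top_unique)
    have "(\<integral>\<^sup>+ x. ennreal (min (V x) (real n)) \<partial>\<pi>)
        = (\<integral>\<^sup>+ x. ennreal (min (V x) (real n)) \<partial>(\<pi> \<bind> P))"
      by (simp add: inv)
    also have "\<dots> = (\<integral>\<^sup>+ x. (\<integral>\<^sup>+ y. ennreal (min (V y) (real n)) \<partial>P x) \<partial>\<pi>)"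
      using mtk_measurable_subprob[OF P] sets
      by (intro nn_integral_bind[where B = M]) (auto cong: measurable_cong_sets)
    also have "\<dots> \<le> ?b"
    proof (rule nn_integral_mono)
      fix x assume "x \<in> space \<pi>"
      then have x: "x \<in> space M" by (simp add: space)
      interpret Px: prob_space "P x" by (rule P_prob[OF x])
      have "(\<integral>\<^sup>+ y. ennreal (min (V y) (real n)) \<partial>P x) \<le> (\<integral>\<^sup>+ y. ennreal (V y) \<partial>P x)"
        by (intro nn_integral_mono ennreal_leI) auto
      also note drift[OF x]
      finally have 1: "(\<integral>\<^sup>+ y. ennreal (min (V y) (real n)) \<partial>P x) \<le> ennreal (\<eta> * V x + L)" .
      have "(\<integral>\<^sup>+ y. ennreal (min (V y) (real n)) \<partial>P x) \<le> (\<integral>\<^sup>+ y. ennreal (real n) \<partial>P x)"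
        by (intro nn_integral_mono ennreal_leI) auto
      then have 2: "(\<integral>\<^sup>+ y. ennreal (min (V y) (real n)) \<partial>P x) \<le> ennreal (real n)"
        by (simp add: Px.emeasure_space_1)
      show "(\<integral>\<^sup>+ y. ennreal (min (V y) (real n)) \<partial>P x) \<le> ennreal (min (\<eta> * V x + L) (real n))"
        using 1 2 by (simp add: min_def)
    qed
    finally have le: "(\<integral>\<^sup>+ x. ennreal (min (V x) (real n)) \<partial>\<pi>) \<le> ?b" .
    have "?b + (\<integral>\<^sup>+ x. ennreal (?h n x) \<partial>\<pi>)
        = (\<integral>\<^sup>+ x. ennreal (min (\<eta> * V x + L) (real n)) + ennreal (?h n x) \<partial>\<pi>)"
      by (rule nn_integral_add[symmetric]) measurable
    also have "\<dots> = (\<integral>\<^sup>+ x. ennreal (min (V x) (real n)) + ennreal L \<partial>\<pi>)"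
    proof (rule nn_integral_cong)
      fix x assume "x \<in> space \<pi>"
      then have x: "x \<in> space M" by (simp add: space)
      then have "0 \<le> min (\<eta> * V x + L) (real n)" "0 \<le> min (V x) (real n)"
        using V_nonneg \<eta> L by auto
      then show "ennreal (min (\<eta> * V x + L) (real n)) + ennreal (?h n x)
          = ennreal (min (V x) (real n)) + ennreal L"
        using h_nonneg[OF x] L by (simp flip: ennreal_plus)
    qed
    also have "\<dots> = (\<integral>\<^sup>+ x. ennreal (min (V x) (real n)) \<partial>\<pi>) + ennreal L"
      by (simp add: nn_integral_add emeasure_space_1)
    also have "\<dots> \<le> ?b + ennreal L"
      using le by (rule add_right_mono)
    finally show ?thesis
      using fin by (simp add: ennreal_add_left_cancel_le)
  qed
  have lim: "liminf (\<lambda>n. ennreal (?h n x)) = ennreal ((1 - \<eta>) * V x)" for x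
  proof (intro lim_imp_Liminf tendsto_eventually)
    have "eventually (\<lambda>n. max (V x) (\<eta> * V x + L) \<le> real n) sequentially"
      using filterlim_real_sequentially unfolding filterlim_at_top by blast
    then show "eventually (\<lambda>n. ennreal (?h n x) = ennreal ((1 - \<eta>) * V x)) sequentially"
      by eventually_elim (auto simp: min_def algebra_simps)
  qed simp
  have "(\<integral>\<^sup>+ x. ennreal ((1 - \<eta>) * V x) \<partial>\<pi>) = (\<integral>\<^sup>+ x. liminf (\<lambda>n. ennreal (?h n x)) \<partial>\<pi>)"
    by (simp only: lim)
  also have "\<dots> \<le> liminf (\<lambda>n. \<integral>\<^sup>+ x. ennreal (?h n x) \<partial>\<pi>)"
    by (rule nn_integral_liminf) measurable
  also have "\<dots> \<le> ennreal L"
    using h_int by (intro Liminf_le) auto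
  finally show ?thesis .
qed

lemma stationary_sublevel_gt_half:
  assumes P: "mtk M P" and \<pi>: "stationary M P \<pi>"
    and V[measurable]: "V \<in> borel_measurable M" and V_nonneg: "\<And>x. x \<in> space M \<Longrightarrow> 0 \<le> V x"
    and \<eta>: "0 \<le> \<eta>" "\<eta> < 1" and L: "0 \<le> L"
    and drift: "\<And>x. x \<in> space M \<Longrightarrow> (\<integral>\<^sup>+ y. ennreal (V y) \<partial>P x) \<le> ennreal (\<eta> * V x + L)"
    and d: "0 < d" "d > 2 * L / (1 - \<eta>)"
  shows "measure \<pi> {x \<in> space M. V x \<le> d} > 1 / 2"
proof -
  have sets[measurable_cong]: "sets \<pi> = sets M" and "prob_space \<pi>"
    using \<pi> by (auto simp: stationary_def space_prob_algebra)
  then interpret prob_space \<pi> by simp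
  have space: "space \<pi> = space M"
    by (rule sets_eq_imp_space_eq[OF sets])
  let ?D = "{x \<in> space M. d < V x}"
  have D: "?D \<in> events"
    unfolding space[symmetric] by measurable
  have "ennreal ((1 - \<eta>) * d * prob ?D) = (\<integral>\<^sup>+ x. ennreal ((1 - \<eta>) * d) * indicator ?D x \<partial>\<pi>)"
    using D \<eta> d by (simp add: nn_integral_cmult_indicator emeasure_eq_measure ennreal_mult)
  also have "\<dots> \<le> (\<integral>\<^sup>+ x. ennreal ((1 - \<eta>) * V x) \<partial>\<pi>)"
    using \<eta> by (intro nn_integral_mono) (auto simp: indicator_def intro!: ennreal_leI mult_left_mono)
  also have "\<dots> \<le> ennreal L"
    by (rule stationary_drift_integral_le[OF P \<pi> V V_nonneg \<eta> L drift])
  finally have "(1 - \<eta>) * d * prob ?D \<le> L"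
    using L by simp
  moreover have "2 * L < (1 - \<eta>) * d"
    using d \<eta> by (simp add: field_simps)
  ultimately have "((1 - \<eta>) * d) * prob ?D < ((1 - \<eta>) * d) * (1 / 2)"
    by linarith
  then have "prob ?D < 1 / 2"
    using \<eta> d by (subst (asm) mult_less_cancel_left_pos) auto
  moreover have "{x \<in> space M. V x \<le> d} = space \<pi> - ?D"
    by (auto simp: space)
  ultimately show ?thesis
    using prob_compl[OF D] by simp
qed

section \<open>The lower bound on the optimal rate\<close>

lemma eps_C_ge:
  assumes "0 < \<epsilon>" "\<epsilon> \<le> 1" "\<nu> \<in> space (prob_algebra M)" "minorizes M P C \<epsilon> \<nu>"
  shows "\<epsilon> \<le> eps_C M P C"
proof -
  have "\<epsilon> \<in> eps_set M P C"
    using assms by (auto simp: eps_set_def)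
  moreover have "bdd_above (eps_set M P C)"
    by (intro bdd_aboveI[of _ 1]) (auto simp: eps_set_def)
  ultimately show ?thesis
    by (auto simp: eps_C_def intro: cSup_upper)
qed

theorem theorem20:
  fixes M :: "'a measure" and P :: "'a \<Rightarrow> 'a measure" and \<pi> :: "'a measure"
    and \<U> :: "'u measure set"
  assumes "state_space_family \<U>"
    and "mtk M P"
    and "T_params M P \<noteq> {}"
    and "stationary M P \<pi>"
  shows "rho_opt_dagger \<U> M P
           \<ge> (INF C\<in>{C \<in> sets M. measure \<pi> C > 1 / 2}. ennreal (1 - eps_C M P C))"
  unfolding rho_opt_dagger_def
proof (rule INF_greatest)
  fix \<theta> assume \<theta>: "\<theta> \<in> T_params M P"
  obtain \<eta> L \<epsilon> d where [simp]: "\<theta> = (\<eta>, L, \<epsilon>, d)"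
    by (cases \<theta>)
  from \<theta> have \<eta>: "0 \<le> \<eta>" "\<eta> < 1" and L: "0 \<le> L" and \<epsilon>: "0 < \<epsilon>" "\<epsilon> \<le> 1"
    and "drift_minorization M P (\<eta>, L, \<epsilon>, d)"
    by (auto simp: T_params_def T0_def)
  then obtain V \<nu> where V[measurable]: "V \<in> borel_measurable M"
    and V_nonneg: "\<And>x. x \<in> space M \<Longrightarrow> 0 \<le> V x"
    and \<nu>: "\<nu> \<in> space (prob_algebra M)"
    and drift: "\<And>x. x \<in> space M \<Longrightarrow> (\<integral>\<^sup>+ y. ennreal (V y) \<partial>P x) \<le> ennreal (\<eta> * V x + L)"
    and d: "0 < d" "d > 2 * L / (1 - \<eta>)"
    and minor: "minorizes M P {x \<in> space M. V x \<le> d} \<epsilon> \<nu>"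
    by auto
  let ?C = "{x \<in> space M. V x \<le> d}"
  have "measure \<pi> ?C > 1 / 2"
    by (rule stationary_sublevel_gt_half[OF assms(2,4) V V_nonneg \<eta> L drift d])
  then have "(INF C\<in>{C \<in> sets M. measure \<pi> C > 1 / 2}. ennreal (1 - eps_C M P C))
      \<le> ennreal (1 - eps_C M P ?C)"
    by (intro INF_lower) auto
  also have "\<dots> \<le> ennreal (1 - \<epsilon>)"
    using eps_C_ge[OF \<epsilon> \<nu> minor] by (intro ennreal_leI) simp
  also have "\<dots> \<le> rho_opt \<U> \<theta>"
  (* For \<epsilon> = 1 the bound is 0; the logarithmic estimate behind rho_opt_ge needs 1 - \<epsilon> > 0. *)
  proof (cases "\<epsilon> = 1")
    case False
    then show ?thesis
      using rho_opt_ge[OF assms(1) \<epsilon>(1) _ L d] \<epsilon> by simp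
  qed simp
  finally show "(INF C\<in>{C \<in> sets M. measure \<pi> C > 1 / 2}. ennreal (1 - eps_C M P C))
      \<le> rho_opt \<U> \<theta>" .
qed

end
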